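(* Let $F$ be a field of characteristic different from $2$ and $3$. Then there exists a unital associative $F$-algebra $R$ such that the Lie algebra $[R]$ is $5$-Engel but the group of units $U(R)$ is not a $5$-Engel group. Moreover, such an $R$ can be chosen to be generated, as a unital $F$-algebra, by $2$ nilpotent elements.
   Context: For an associative algebra $R$, $[R]$ denotes the Lie algebra with the same underlying vector space and bracket $[a,b]=ab-ba$, and $U(R)$ denotes the group of units of $R$. Set $[x,{}_{(1)}y]=[x,y]$ and $[x,{}_{(k+1)}y]=[[x,{}_{(k)}y],y]$ for $k\ge 1$. A Lie algebra $L$ is $n$-Engel if $[u,{}_{(n)}v]=0$ for all $u,v\in L$. For a group, $(x,y)=(x,{}_{(1)}y)=x^{-1}y^{-1}xy$ and $(x,{}_{(k+1)}y)=((x,{}_{(k)}y),y)$; a group $G$ is $n$-Engel if $(u,{}_{(n)}v)=1$ for all $u,v\in G$. *)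

theory Defs
  imports "HOL-Algebra.Algebra"
begin

text \<open>A unital associative (not necessarily commutative) algebra over a field K.
  The library locale algebra requires commutativity, so we define our own notion.\<close>
definition unital_assoc_algebra :: "('k, 'm) ring_scheme \<Rightarrow> ('k, 'r) module \<Rightarrow> bool" where
  "unital_assoc_algebra K R \<longleftrightarrow>
     field K \<and> ring R \<and> module K R \<and>
     (\<forall>a\<in>carrier K. \<forall>x\<in>carrier R. \<forall>y\<in>carrier R.
        (a \<odot>\<^bsub>R\<^esub> x) \<otimes>\<^bsub>R\<^esub> y = a \<odot>\<^bsub>R\<^esub> (x \<otimes>\<^bsub>R\<^esub> y) \<and>
        x \<otimes>\<^bsub>R\<^esub> (a \<odot>\<^bsub>R\<^esub> y) = a \<odot>\<^bsub>R\<^esub> (x \<otimes>\<^bsub>R\<^esub> y))"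

definition lie_bracket :: "('r, 'm) ring_scheme \<Rightarrow> 'r \<Rightarrow> 'r \<Rightarrow> 'r" where
  "lie_bracket R a b = a \<otimes>\<^bsub>R\<^esub> b \<ominus>\<^bsub>R\<^esub> b \<otimes>\<^bsub>R\<^esub> a"

primrec lie_iter :: "('r, 'm) ring_scheme \<Rightarrow> 'r \<Rightarrow> nat \<Rightarrow> 'r \<Rightarrow> 'r" where
  "lie_iter R x 0 y = x"
| "lie_iter R x (Suc k) y = lie_bracket R (lie_iter R x k y) y"

definition lie_engel :: "('r, 'm) ring_scheme \<Rightarrow> nat \<Rightarrow> bool" where
  "lie_engel R n \<longleftrightarrow> (\<forall>u\<in>carrier R. \<forall>v\<in>carrier R. lie_iter R u n v = \<zero>\<^bsub>R\<^esub>)"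

definition grp_comm :: "('g, 'm) monoid_scheme \<Rightarrow> 'g \<Rightarrow> 'g \<Rightarrow> 'g" where
  "grp_comm G x y = inv\<^bsub>G\<^esub> x \<otimes>\<^bsub>G\<^esub> inv\<^bsub>G\<^esub> y \<otimes>\<^bsub>G\<^esub> x \<otimes>\<^bsub>G\<^esub> y"

primrec grp_comm_iter :: "('g, 'm) monoid_scheme \<Rightarrow> 'g \<Rightarrow> nat \<Rightarrow> 'g \<Rightarrow> 'g" where
  "grp_comm_iter G x 0 y = x"
| "grp_comm_iter G x (Suc k) y = grp_comm G (grp_comm_iter G x k y) y"

definition group_engel :: "('g, 'm) monoid_scheme \<Rightarrow> nat \<Rightarrow> bool" where
  "group_engel G n \<longleftrightarrow> (\<forall>u\<in>carrier G. \<forall>v\<in>carrier G. grp_comm_iter G u n v = \<one>\<^bsub>G\<^esub>)"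

inductive_set alg_generated :: "('k, 'm) ring_scheme \<Rightarrow> ('k, 'r) module \<Rightarrow> 'r set \<Rightarrow> 'r set"
  for K R S where
  gen: "s \<in> S \<Longrightarrow> s \<in> alg_generated K R S"
| one: "\<one>\<^bsub>R\<^esub> \<in> alg_generated K R S"
| add: "x \<in> alg_generated K R S \<Longrightarrow> y \<in> alg_generated K R S \<Longrightarrow> x \<oplus>\<^bsub>R\<^esub> y \<in> alg_generated K R S"
| mult: "x \<in> alg_generated K R S \<Longrightarrow> y \<in> alg_generated K R S \<Longrightarrow> x \<otimes>\<^bsub>R\<^esub> y \<in> alg_generated K R S"
| smult: "a \<in> carrier K \<Longrightarrow> x \<in> alg_generated K R S \<Longrightarrow> a \<odot>\<^bsub>R\<^esub> x \<in> alg_generated K R S"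

definition nilpotent_elem :: "('r, 'm) ring_scheme \<Rightarrow> 'r \<Rightarrow> bool" where
  "nilpotent_elem R x \<longleftrightarrow> (\<exists>m::nat. x [^]\<^bsub>R\<^esub> m = \<zero>\<^bsub>R\<^esub>)"

end

theory Submission
  imports Defs
begin

text \<open>
  Put \<open>A = K[y]/(y\<^sup>3)\<close> and \<open>B = A \<otimes> A = K[s, t]/(s\<^sup>3, t\<^sup>3)\<close>, where \<open>s\<close> and \<open>t\<close>
  stand for multiplication by \<open>y\<close> from the left and from the right. The algebra is
  \<open>R = A \<oplus> B x \<oplus> B w\<close>, of dimension 21, with \<open>x x = 0\<close>, \<open>x y x = -3 w\<close>,
  \<open>x y\<^sup>2 x = 5 (y w + w y)\<close> and zero products of degree three in \<open>x\<close> (\<open>w\<close> has degree two).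
  With \<open>D\<close> the difference of the right and left actions of the \<open>A\<close>-part of \<open>v\<close>, bracketing with
  \<open>v\<close> multiplies by \<open>D\<close>, up to a correction in \<open>B w\<close>; since \<open>D\<^sup>5 = 0\<close>, only the correction terms
  in \<open>[u, v, v, v, v, v]\<close> matter, and the constants \<open>-3\<close> and \<open>5\<close> are chosen so that they cancel.
  The group commutator differs from the Lie bracket in degree two in \<open>x\<close> by a term that does not
  cancel: the fivefold commutator of \<open>1 + x\<close> with \<open>1 + y\<close> is \<open>1 - 18 y\<^sup>2 w y\<^sup>2\<close>.

  All of this is a computation with integer polynomials. It is carried out over a type-class ring,
  the free commutative ring on the type of \<open>K\<close>, and pushed down to \<open>K\<close> by evaluation.
\<close>

section \<open>The free commutative ring on a type\<close>

datatype 'k ring_term =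
  Var 'k | Zero | One
  | Add "'k ring_term" "'k ring_term" | Neg "'k ring_term" | Mul "'k ring_term" "'k ring_term"

inductive ring_eq :: "'k ring_term \<Rightarrow> 'k ring_term \<Rightarrow> bool" where
  refl: "ring_eq a a"
| sym: "ring_eq a b \<Longrightarrow> ring_eq b a"
| trans: "ring_eq a b \<Longrightarrow> ring_eq b c \<Longrightarrow> ring_eq a c"
| add_cong: "ring_eq a a' \<Longrightarrow> ring_eq b b' \<Longrightarrow> ring_eq (Add a b) (Add a' b')"
| neg_cong: "ring_eq a a' \<Longrightarrow> ring_eq (Neg a) (Neg a')"
| mul_cong: "ring_eq a a' \<Longrightarrow> ring_eq b b' \<Longrightarrow> ring_eq (Mul a b) (Mul a' b')"
| add_assoc: "ring_eq (Add (Add a b) c) (Add a (Add b c))"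
| add_commute: "ring_eq (Add a b) (Add b a)"
| add_zero: "ring_eq (Add Zero a) a"
| add_neg: "ring_eq (Add (Neg a) a) Zero"
| mul_assoc: "ring_eq (Mul (Mul a b) c) (Mul a (Mul b c))"
| mul_commute: "ring_eq (Mul a b) (Mul b a)"
| mul_one: "ring_eq (Mul One a) a"
| distrib: "ring_eq (Mul (Add a b) c) (Add (Mul a c) (Mul b c))"

text \<open>Shows that \<open>0 \<noteq> 1\<close> in the quotient.\<close>

primrec int_eval :: "'k ring_term \<Rightarrow> int" where
  "int_eval (Var x) = 0"
| "int_eval Zero = 0"
| "int_eval One = 1"
| "int_eval (Add a b) = int_eval a + int_eval b"
| "int_eval (Neg a) = - int_eval a"
| "int_eval (Mul a b) = int_eval a * int_eval b"

lemma int_eval_cong: "ring_eq a b \<Longrightarrow> int_eval a = int_eval b"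
  by (induction rule: ring_eq.induct) (simp_all add: algebra_simps)

quotient_type 'k free_cring = "'k ring_term" / ring_eq
  by (intro equivpI reflpI sympI transpI) (fact ring_eq.refl ring_eq.sym ring_eq.trans)+

instantiation free_cring :: (type) comm_ring_1
begin

lift_definition zero_free_cring :: "'a free_cring" is Zero .
lift_definition one_free_cring :: "'a free_cring" is One .
lift_definition plus_free_cring :: "'a free_cring \<Rightarrow> 'a free_cring \<Rightarrow> 'a free_cring" is Add
  by (fact ring_eq.add_cong)
lift_definition uminus_free_cring :: "'a free_cring \<Rightarrow> 'a free_cring" is Neg
  by (fact ring_eq.neg_cong)
lift_definition minus_free_cring :: "'a free_cring \<Rightarrow> 'a free_cring \<Rightarrow> 'a free_cring"
  is "\<lambda>a b. Add a (Neg b)"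
  by (intro ring_eq.add_cong ring_eq.neg_cong)
lift_definition times_free_cring :: "'a free_cring \<Rightarrow> 'a free_cring \<Rightarrow> 'a free_cring" is Mul
  by (fact ring_eq.mul_cong)

instance
proof
  fix a b c :: "'a free_cring"
  show "a * b * c = a * (b * c)" by transfer (fact ring_eq.mul_assoc)
  show "a * b = b * a" by transfer (fact ring_eq.mul_commute)
  show "1 * a = a" by transfer (fact ring_eq.mul_one)
  show "(a + b) * c = a * c + b * c" by transfer (fact ring_eq.distrib)
  show "a + b + c = a + (b + c)" by transfer (fact ring_eq.add_assoc)
  show "a + b = b + a" by transfer (fact ring_eq.add_commute)
  show "0 + a = a" by transfer (fact ring_eq.add_zero)
  show "- a + a = 0" by transfer (fact ring_eq.add_neg)
  show "a - b = a + - b" by transfer (fact ring_eq.refl)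
  show "(0 :: 'a free_cring) \<noteq> 1" by transfer (auto dest: int_eval_cong)
qed

end

text \<open>Names outside the carrier are sent to zero, so evaluation is total on terms and never
  leaves \<open>K\<close>.\<close>

primrec term_eval :: "('k, 'm) ring_scheme \<Rightarrow> 'k ring_term \<Rightarrow> 'k" where
  "term_eval K (Var x) = (if x \<in> carrier K then x else \<zero>\<^bsub>K\<^esub>)"
| "term_eval K Zero = \<zero>\<^bsub>K\<^esub>"
| "term_eval K One = \<one>\<^bsub>K\<^esub>"
| "term_eval K (Add a b) = term_eval K a \<oplus>\<^bsub>K\<^esub> term_eval K b"
| "term_eval K (Neg a) = \<ominus>\<^bsub>K\<^esub> term_eval K a"
| "term_eval K (Mul a b) = term_eval K a \<otimes>\<^bsub>K\<^esub> term_eval K b"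

text \<open>Evaluation respects \<open>ring_eq\<close> only if \<open>K\<close> is a commutative
  ring, which its type does not say. Hence it goes through a representative instead of being
  lifted.\<close>

definition eval_in :: "('k, 'm) ring_scheme \<Rightarrow> 'k free_cring \<Rightarrow> 'k" where
  "eval_in K a = term_eval K (rep_free_cring a)"

context cring
begin

lemma term_eval_closed: "term_eval R a \<in> carrier R"
  by (induction a) auto

lemma term_eval_cong: "ring_eq a b \<Longrightarrow> term_eval R a = term_eval R b"
  by (induction rule: ring_eq.induct)
    (simp_all add: term_eval_closed a_ac m_ac r_neg l_distr r_distr)

lemma eval_in_abs: "eval_in R (abs_free_cring a) = term_eval R a"
  unfolding eval_in_def
  by (rule term_eval_cong) (meson Quotient_free_cring Quotient_rep_abs ring_eq.refl)

lemma eval_in_add: "eval_in R (a + b) = eval_in R a \<oplus> eval_in R b"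
  by (induction a; induction b) (simp add: plus_free_cring.abs_eq eval_in_abs)

lemma eval_in_diff: "eval_in R (a - b) = eval_in R a \<ominus> eval_in R b"
  by (induction a; induction b) (simp add: minus_free_cring.abs_eq eval_in_abs minus_eq)

lemma eval_in_mult: "eval_in R (a * b) = eval_in R a \<otimes> eval_in R b"
  by (induction a; induction b) (simp add: times_free_cring.abs_eq eval_in_abs)

lemma eval_in_one: "eval_in R 1 = \<one>"
  by (simp add: one_free_cring_def eval_in_abs)

lemma range_eval_in: "range (eval_in R) = carrier R"
proof
  show "range (eval_in R) \<subseteq> carrier R"
    by (auto simp: eval_in_def term_eval_closed)
  show "carrier R \<subseteq> range (eval_in R)"
  proof
    fix x assume "x \<in> carrier R"
    then have "x = eval_in R (abs_free_cring (Var x))"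
      by (simp add: eval_in_abs)
    then show "x \<in> range (eval_in R)" by blast
  qed
qed

end

section \<open>Quotients of type-class algebras\<close>

text \<open>\<open>ev\<close> presents \<open>K\<close> as a quotient of a type-class ring,
  \<open>em\<close> maps scalars into the centre of a type-class algebra, and the fibres of
  \<open>E\<close> are the classes of a congruence on that algebra.\<close>

locale quotient_algebra = K: field K
  for K :: "('k, 'm) ring_scheme" (structure) +
  fixes ev :: "'a :: comm_ring_1 \<Rightarrow> 'k"
    and em :: "'a \<Rightarrow> 'x :: ring_1"
    and E :: "'x \<Rightarrow> 'r"
  assumes ev_add: "ev (a + b) = ev a \<oplus> ev b"
    and ev_mult: "ev (a * b) = ev a \<otimes> ev b"
    and ev_one: "ev 1 = \<one>"
    and range_ev: "range ev = carrier K"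
    and em_add: "em (a + b) = em a + em b"
    and em_mult: "em (a * b) = em a * em b"
    and em_one: "em 1 = 1"
    and em_central: "em a * x = x * em a"
    and E_em: "ev a = ev b \<Longrightarrow> E (em a) = E (em b)"
    and E_add: "E x = E x' \<Longrightarrow> E y = E y' \<Longrightarrow> E (x + y) = E (x' + y')"
    and E_mult: "E x = E x' \<Longrightarrow> E y = E y' \<Longrightarrow> E (x * y) = E (x' * y')"
begin

text \<open>Operations are performed on arbitrary preimages. The congruence assumptions on
  \<open>E\<close> make the choice irrelevant.\<close>

definition quot :: "('k, 'r) module" where
  "quot = \<lparr>carrier = range E,
     monoid.mult = \<lambda>x y. E (inv_into UNIV E x * inv_into UNIV E y), monoid.one = E 1,
     ring.zero = E 0, ring.add = \<lambda>x y. E (inv_into UNIV E x + inv_into UNIV E y),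
     module.smult = \<lambda>k x. E (em (inv_into UNIV ev k) * inv_into UNIV E x)\<rparr>"

lemma E_inv: "E (inv_into UNIV E (E x)) = E x"
  by (simp add: f_inv_into_f)

lemma ev_inv: "ev (inv_into UNIV ev (ev a)) = ev a"
  by (simp add: f_inv_into_f)

lemma quot_simps:
  "carrier quot = range E" "\<one>\<^bsub>quot\<^esub> = E 1" "\<zero>\<^bsub>quot\<^esub> = E 0"
  "E x \<otimes>\<^bsub>quot\<^esub> E y = E (x * y)" "E x \<oplus>\<^bsub>quot\<^esub> E y = E (x + y)"
  "ev a \<odot>\<^bsub>quot\<^esub> E x = E (em a * x)"
  by (auto simp: quot_def E_inv ev_inv intro!: E_add E_mult E_em)

lemma ev_closed: "ev a \<in> carrier K"
  using range_ev by blast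

lemma ev_zero: "ev 0 = \<zero>"
  using ev_add[of 0 0] ev_closed[of 0] by (metis K.add.r_cancel_one' add_0)

lemma ring_quot: "ring quot"
proof (rule ringI)
  show "abelian_group quot"
  proof (rule abelian_groupI)
    fix x assume "x \<in> carrier quot"
    then obtain a where "x = E a" by (auto simp: quot_simps)
    then have "E (- a) \<oplus>\<^bsub>quot\<^esub> x = \<zero>\<^bsub>quot\<^esub>" by (simp add: quot_simps)
    then show "\<exists>y\<in>carrier quot. y \<oplus>\<^bsub>quot\<^esub> x = \<zero>\<^bsub>quot\<^esub>" by (auto simp: quot_simps)
  qed (auto simp: quot_simps algebra_simps)
  show "Group.monoid quot"
    by (rule monoidI) (auto simp: quot_simps algebra_simps)
qed (auto simp: quot_simps algebra_simps)

lemma ev_surj: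
  assumes "k \<in> carrier K"
  obtains a where "k = ev a"
  using assms range_ev by blast

lemma unital_assoc_algebra_quot: "unital_assoc_algebra K quot"
proof -
  \<comment> \<open>With scalars written as values of \<open>ev\<close>, the module laws become ring
    identities under \<open>E\<close>.\<close>
  have "module K quot"
  proof (intro module.intro module_axioms.intro)
    show "cring K" by unfold_locales
    show "abelian_group quot" using ring_quot by (rule ring.is_abelian_group)
  qed (auto simp: quot_simps em_add em_mult em_one algebra_simps
      elim!: ev_surj simp flip: ev_add ev_mult ev_one)
  moreover have "(k \<odot>\<^bsub>quot\<^esub> x) \<otimes>\<^bsub>quot\<^esub> y = k \<odot>\<^bsub>quot\<^esub> (x \<otimes>\<^bsub>quot\<^esub> y) \<and>
        x \<otimes>\<^bsub>quot\<^esub> (k \<odot>\<^bsub>quot\<^esub> y) = k \<odot>\<^bsub>quot\<^esub> (x \<otimes>\<^bsub>quot\<^esub> y)"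
    if k: "k \<in> carrier K" and xy: "x \<in> carrier quot" "y \<in> carrier quot" for k x y
  proof -
    obtain a where "k = ev a"
      using k by (rule ev_surj)
    moreover obtain s t where "x = E s" "y = E t"
      using xy by (auto simp: quot_simps)
    moreover have "s * (em a * t) = em a * (s * t)"
      by (metis em_central mult.assoc)
    ultimately show ?thesis by (simp add: quot_simps mult.assoc)
  qed
  ultimately show ?thesis
    unfolding unital_assoc_algebra_def using ring_quot K.field_axioms by blast
qed

lemma quot_minus: "E x \<ominus>\<^bsub>quot\<^esub> E y = E (x - y)"
proof -
  interpret Q: ring quot by (rule ring_quot)
  have "\<ominus>\<^bsub>quot\<^esub> E y = E (- y)"
    by (rule Q.minus_equality) (auto simp: quot_simps)
  then show ?thesis by (simp add: a_minus_def quot_simps)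
qed

lemma lie_iter_quot: "lie_iter quot (E u) n (E v) = E (((\<lambda>w. w * v - v * w) ^^ n) u)"
  by (induction n) (simp_all add: lie_bracket_def quot_simps quot_minus)

lemma pow_quot: "E x [^]\<^bsub>quot\<^esub> (n :: nat) = E (x ^ n)"
proof -
  interpret Q: ring quot by (rule ring_quot)
  show ?thesis
    by (induction n) (simp_all add: quot_simps power_commutes)
qed

lemma unit_quot:
  assumes "g * h = 1" "h * g = 1"
  shows "E g \<in> Units quot"
proof -
  have "E h \<otimes>\<^bsub>quot\<^esub> E g = \<one>\<^bsub>quot\<^esub>" "E g \<otimes>\<^bsub>quot\<^esub> E h = \<one>\<^bsub>quot\<^esub>"
    using assms by (simp_all add: quot_simps)
  then show ?thesis by (auto simp: Units_def quot_simps)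
qed

lemma inv_quot:
  assumes "g * h = 1" "h * g = 1"
  shows "inv\<^bsub>units_of quot\<^esub> E g = E h"
proof -
  interpret Q: ring quot by (rule ring_quot)
  have "inv\<^bsub>quot\<^esub> E g = E h"
    by (rule Q.inv_unique'[symmetric]) (use assms in \<open>auto simp: quot_simps\<close>)
  then show ?thesis
    using Q.units_of_inv[OF unit_quot[OF assms]] by simp
qed

lemma grp_comm_quot:
  assumes "g * g' = 1" "g' * g = 1" "h * h' = 1" "h' * h = 1"
  shows "grp_comm (units_of quot) (E g) (E h) = E (g' * h' * g * h)"
  unfolding grp_comm_def inv_quot[OF assms(1,2)] inv_quot[OF assms(3,4)]
  by (simp add: units_of_mult quot_simps)

lemma alg_generated_quot_subset:
  "S \<subseteq> range E \<Longrightarrow> alg_generated K quot S \<subseteq> carrier quot"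
proof
  fix x assume S: "S \<subseteq> range E" and "x \<in> alg_generated K quot S"
  from this(2) show "x \<in> carrier quot"
  proof induction
    case (smult a x)
    then show ?case by (auto simp: quot_simps elim!: ev_surj)
  qed (use S in \<open>auto simp: quot_simps\<close>)
qed

lemma alg_generated_quot:
  shows alg_generated_add:
    "E x \<in> alg_generated K quot S \<Longrightarrow> E y \<in> alg_generated K quot S \<Longrightarrow> E (x + y) \<in> alg_generated K quot S"
  and alg_generated_mult:
    "E x \<in> alg_generated K quot S \<Longrightarrow> E y \<in> alg_generated K quot S \<Longrightarrow> E (x * y) \<in> alg_generated K quot S"
  and alg_generated_scale:
    "E x \<in> alg_generated K quot S \<Longrightarrow> E (em a * x) \<in> alg_generated K quot S"
  and alg_generated_one: "E 1 \<in> alg_generated K quot S"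
  using alg_generated.add[of "E x" K quot S "E y"] alg_generated.mult[of "E x" K quot S "E y"]
    alg_generated.smult[of "ev a" K "E x" quot S] alg_generated.one[of quot K S]
  by (simp_all add: quot_simps ev_closed)

end

section \<open>The bimodule and its multiplication\<close>

text \<open>\<open>Trunc a b c\<close> is \<open>a + b y + c y\<^sup>2\<close> modulo \<open>y\<^sup>3\<close>. In the iterated type, the outer variable is
  \<open>s\<close> and the inner one \<open>t\<close>.\<close>

datatype 'a trunc = Trunc 'a 'a 'a

instantiation trunc :: (comm_ring_1) comm_ring_1
begin

definition "0 = Trunc 0 0 0"
definition "1 = Trunc 1 0 0"

fun plus_trunc :: "'a trunc \<Rightarrow> 'a trunc \<Rightarrow> 'a trunc" where
  "Trunc a b c + Trunc a' b' c' = Trunc (a + a') (b + b') (c + c')"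

fun minus_trunc :: "'a trunc \<Rightarrow> 'a trunc \<Rightarrow> 'a trunc" where
  "Trunc a b c - Trunc a' b' c' = Trunc (a - a') (b - b') (c - c')"

fun uminus_trunc :: "'a trunc \<Rightarrow> 'a trunc" where
  "- Trunc a b c = Trunc (- a) (- b) (- c)"

fun times_trunc :: "'a trunc \<Rightarrow> 'a trunc \<Rightarrow> 'a trunc" where
  "Trunc a b c * Trunc a' b' c' = Trunc (a * a') (a * b' + b * a') (a * c' + b * b' + c * a')"

instance
proof
  fix x y z :: "'a trunc"
  show "x * y * z = x * (y * z)"
    by (cases x; cases y; cases z) (simp add: algebra_simps)
  show "x * y = y * x"
    by (cases x; cases y) (simp add: algebra_simps)
  show "1 * x = x"
    by (cases x) (simp add: one_trunc_def)
  show "(x + y) * z = x * z + y * z"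
    by (cases x; cases y; cases z) (simp add: algebra_simps)
  show "x + y + z = x + (y + z)"
    by (cases x; cases y; cases z) (simp add: algebra_simps)
  show "x + y = y + x"
    by (cases x; cases y) (simp add: algebra_simps)
  show "0 + x = x"
    by (cases x) (simp add: zero_trunc_def)
  show "- x + x = 0"
    by (cases x) (simp add: zero_trunc_def)
  show "x - y = x + - y"
    by (cases x; cases y) simp
  show "(0 :: 'a trunc) \<noteq> 1"
    by (simp add: zero_trunc_def one_trunc_def)
qed

end

lemma trunc2_cases:
  obtains a b c d e f g h i
  where "(p :: 'a trunc trunc) = Trunc (Trunc a b c) (Trunc d e f) (Trunc g h i)"
  by (metis trunc.exhaust)

lemma numeral_trunc: "numeral k = (Trunc (numeral k) 0 0 :: 'a :: comm_ring_1 trunc)"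
proof -
  have "of_nat n = (Trunc (of_nat n) 0 0 :: 'a trunc)" for n
    by (induction n) (simp_all add: zero_trunc_def one_trunc_def)
  from this[of "numeral k"] show ?thesis by simp
qed

lemmas trunc_simps = zero_trunc_def one_trunc_def numeral_trunc

definition const :: "'a \<Rightarrow> 'a :: comm_ring_1 trunc" where
  "const a = Trunc a 0 0"

fun lact :: "'a trunc \<Rightarrow> 'a :: comm_ring_1 trunc trunc" where
  "lact (Trunc a b c) = Trunc (const a) (const b) (const c)"

definition ract :: "'a trunc \<Rightarrow> 'a :: comm_ring_1 trunc trunc" where
  "ract b = Trunc b 0 0"

lemma ract_hom:
  "ract (a + b) = ract a + ract b" "ract (a - b) = ract a - ract b" "ract (a * b) = ract a * ract b"
  "ract 0 = 0" "ract 1 = 1"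
  by (simp_all add: ract_def flip: zero_trunc_def one_trunc_def)

lemma lact_hom:
  "lact (a + b) = lact a + lact b" "lact (a - b) = lact a - lact b" "lact (a * b) = lact a * lact b"
  "lact 0 = 0" "lact 1 = 1"
  by (cases a; cases b; simp add: const_def trunc_simps)+

definition y_gen :: "'a :: comm_ring_1 trunc" where
  "y_gen = Trunc 0 1 0"

text \<open>The product of \<open>p(s, m) x\<close> and \<open>q(m, t) x\<close> replaces the powers \<open>1, m, m\<^sup>2\<close> of the middle
  variable by \<open>0, -3, 5 (s + t)\<close>; \<open>mid1\<close> and \<open>mid2\<close> extract the coefficients of \<open>m\<close> and \<open>m\<^sup>2\<close> for one
  power of \<open>s\<close>. The ratio \<open>-3 : 5\<close> is the one that makes \<open>mu_engel\<close> below true.\<close>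

fun mid1 :: "'a trunc \<Rightarrow> 'a trunc trunc \<Rightarrow> 'a :: comm_ring_1 trunc" where
  "mid1 (Trunc a b c) (Trunc A B C) = const a * B + const b * A"

fun mid2 :: "'a trunc \<Rightarrow> 'a trunc trunc \<Rightarrow> 'a :: comm_ring_1 trunc" where
  "mid2 (Trunc a b c) (Trunc A B C) = const a * C + const b * B + const c * A"

definition mu :: "'a trunc trunc \<Rightarrow> 'a trunc trunc \<Rightarrow> 'a :: comm_ring_1 trunc trunc" where
  "mu p q = 5 * (lact y_gen + ract y_gen) * map_trunc (\<lambda>a. mid2 a q) p - 3 * map_trunc (\<lambda>a. mid1 a q) p"

lemmas mu_simps = mu_def y_gen_def ract_def const_def trunc_simps

lemma mu_lact: "mu (lact a * p) q = lact a * mu p q"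
  by (cases a; cases p rule: trunc2_cases; cases q rule: trunc2_cases)
    (simp add: mu_simps algebra_simps)

lemma mu_ract: "mu p (q * ract a) = mu p q * ract a"
  by (cases a; cases p rule: trunc2_cases; cases q rule: trunc2_cases)
    (simp add: mu_simps algebra_simps)

text \<open>Both sides multiply by \<open>a\<close> in the shared middle variable. Together with
  \<open>mu_lact\<close> and \<open>mu_ract\<close> this is what associativity of the algebra
  requires of \<open>mu\<close>.\<close>

lemma mu_mid: "mu (p * ract a) q = mu p (lact a * q)"
  by (cases a; cases p rule: trunc2_cases; cases q rule: trunc2_cases)
    (simp add: mu_simps algebra_simps)

lemma mu_add: "mu (p + p') q = mu p q + mu p' q" "mu p (q + q') = mu p q + mu p q'"
  by (cases p rule: trunc2_cases; cases q rule: trunc2_cases;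
      cases p' rule: trunc2_cases; cases q' rule: trunc2_cases;
      simp add: mu_simps algebra_simps)+

text \<open>The component in \<open>B w\<close> of the fivefold Lie bracket.\<close>

lemma mu_engel:
  fixes u v :: "'a :: comm_ring_1 trunc" and p q :: "'a trunc trunc"
  defines "D \<equiv> ract v - lact v"
  defines "h \<equiv> D * p - (ract u - lact u) * q"
  shows "D ^ 4 * (mu p q - mu q p) + D ^ 3 * (mu h q - mu q h)
      + D ^ 2 * (mu (D * h) q - mu q (D * h)) + D * (mu (D ^ 2 * h) q - mu q (D ^ 2 * h))
      + (mu (D ^ 3 * h) q - mu q (D ^ 3 * h)) = 0"
  unfolding h_def D_def
  by (cases u; cases v; cases p rule: trunc2_cases; cases q rule: trunc2_cases)
    (simp add: mu_simps power4_eq_xxxx power3_eq_cube power2_eq_square algebra_simps)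

lemma mu_diff: "mu (p - p') q = mu p q - mu p' q" "mu p (q - q') = mu p q - mu p q'"
  by (simp_all add: eq_diff_eq flip: mu_add)

lemma mu_zero: "mu 0 q = 0" "mu p 0 = 0"
  using mu_diff(1)[of 0 0 q] mu_diff(2)[of p 0 0] by simp_all

text \<open>The differences have no constant term, and a monomial of degree five in \<open>s\<close>
  and \<open>t\<close> has an exponent of at least three.\<close>

lemma bracket_power:
  fixes u v :: "'a :: comm_ring_1 trunc"
  shows "(ract v - lact v) ^ 5 = 0" "(ract v - lact v) ^ 4 * (ract u - lact u) = 0"
  by (cases u; cases v; simp add: mu_simps eval_nat_numeral algebra_simps)+

section \<open>The algebra over a type-class ring\<close>

datatype 'a alg = Alg "'a trunc" "'a trunc trunc" "'a trunc trunc"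

instantiation alg :: (comm_ring_1) ring_1
begin

definition "0 = Alg 0 0 0"
definition "1 = Alg 1 0 0"

fun plus_alg :: "'a alg \<Rightarrow> 'a alg \<Rightarrow> 'a alg" where
  "Alg a p q + Alg a' p' q' = Alg (a + a') (p + p') (q + q')"

fun minus_alg :: "'a alg \<Rightarrow> 'a alg \<Rightarrow> 'a alg" where
  "Alg a p q - Alg a' p' q' = Alg (a - a') (p - p') (q - q')"

fun uminus_alg :: "'a alg \<Rightarrow> 'a alg" where
  "- Alg a p q = Alg (- a) (- p) (- q)"

fun times_alg :: "'a alg \<Rightarrow> 'a alg \<Rightarrow> 'a alg" where
  "Alg a p q * Alg a' p' q' =
     Alg (a * a') (lact a * p' + p * ract a') (lact a * q' + q * ract a' + mu p p')"

instance
proof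
  fix x y z :: "'a alg"
  show "x * y * z = x * (y * z)"
    by (cases x; cases y; cases z)
      (simp add: lact_hom ract_hom mu_add mu_lact mu_ract mu_mid
        distrib_left distrib_right mult.assoc add_ac)
  show "1 * x = x" "x * 1 = x"
    by (cases x; simp add: one_alg_def lact_hom ract_hom mu_zero)+
  show "(x + y) * z = x * z + y * z" "x * (y + z) = x * y + x * z"
    by (cases x; cases y; cases z; simp add: lact_hom ract_hom mu_add algebra_simps)+
  show "x + y + z = x + (y + z)"
    by (cases x; cases y; cases z) (simp add: algebra_simps)
  show "x + y = y + x"
    by (cases x; cases y) (simp add: algebra_simps)
  show "0 + x = x"
    by (cases x) (simp add: zero_alg_def)
  show "- x + x = 0"
    by (cases x) (simp add: zero_alg_def)
  show "x - y = x + - y"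
    by (cases x; cases y) simp
  show "(0 :: 'a alg) \<noteq> 1"
    by (simp add: zero_alg_def one_alg_def)
qed

end

section \<open>The Lie Engel identity\<close>

lemma bracket_alg:
  "Alg a p s * Alg b q r - Alg b q r * Alg a p s =
   Alg 0 ((ract b - lact b) * p - (ract a - lact a) * q)
     ((ract b - lact b) * s - (ract a - lact a) * r + (mu p q - mu q p))"
  by (simp add: algebra_simps)

lemma alg_lie_engel:
  fixes u v :: "'a :: comm_ring_1 alg"
  shows "((\<lambda>w. w * v - v * w) ^^ 5) u = 0"
proof -
  obtain a p s where u: "u = Alg a p s" by (cases u)
  obtain b q r where v: "v = Alg b q r" by (cases v)
  define D where "D = ract b - lact b"
  define U where "U = ract a - lact a"
  define h where "h = D * p - U * q"
  have D5: "D ^ 5 = 0" and D4U: "D ^ 4 * U = 0"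
    unfolding D_def U_def by (fact bracket_power)+
  \<comment> \<open>The first bracket removes the \<open>A\<close>-part because \<open>A\<close> is
    commutative, so from the second bracket on only \<open>D\<close> and the \<open>mu\<close>
    correction act.\<close>
  have step: "Alg 0 p s * v - v * Alg 0 p s = Alg 0 (D * p) (D * s + (mu p q - mu q p))" for p s
    unfolding v bracket_alg D_def by (simp add: lact_hom ract_hom)
  have first: "u * v - v * u = Alg 0 h (D * s - U * r + (mu p q - mu q p))"
    unfolding u v bracket_alg D_def U_def h_def ..
  have "((\<lambda>w. w * v - v * w) ^^ 5) u = Alg 0 (D ^ 4 * h)
     (D ^ 5 * s - D ^ 4 * U * r + (D ^ 4 * (mu p q - mu q p) + D ^ 3 * (mu h q - mu q h)
      + D ^ 2 * (mu (D * h) q - mu q (D * h)) + D * (mu (D ^ 2 * h) q - mu q (D ^ 2 * h))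
      + (mu (D ^ 3 * h) q - mu q (D ^ 3 * h))))"
    by (simp add: first step eval_nat_numeral algebra_simps)
  moreover have "D ^ 4 * h = D ^ 5 * p - D ^ 4 * U * q"
    unfolding h_def by (simp add: eval_nat_numeral algebra_simps)
  moreover have "D ^ 4 * (mu p q - mu q p) + D ^ 3 * (mu h q - mu q h)
      + D ^ 2 * (mu (D * h) q - mu q (D * h)) + D * (mu (D ^ 2 * h) q - mu q (D ^ 2 * h))
      + (mu (D ^ 3 * h) q - mu q (D ^ 3 * h)) = 0"
    unfolding h_def D_def U_def by (fact mu_engel)
  ultimately show ?thesis
    by (simp add: D5 D4U zero_alg_def)
qed

section \<open>Generators and scalars\<close>

definition y_elt :: "'a :: comm_ring_1 alg" where
  "y_elt = Alg y_gen 0 0"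

definition x_elt :: "'a :: comm_ring_1 alg" where
  "x_elt = Alg 0 1 0"

definition scalar :: "'a \<Rightarrow> 'a :: comm_ring_1 alg" where
  "scalar a = Alg (const a) 0 0"

lemma const_hom: "const (a + b) = const a + const b" "const (a * b) = const a * const b" "const 1 = 1"
  by (simp_all add: const_def one_trunc_def)

lemma scalar_hom:
  "scalar (a + b) = scalar a + scalar b" "scalar (a * b) = scalar a * scalar b" "scalar 1 = 1"
  by (simp_all add: scalar_def const_hom one_alg_def lact_hom ract_hom mu_zero)

lemma lact_const: "lact (const a) = ract (const a)"
  by (simp add: ract_def const_def zero_trunc_def)

lemma scalar_central: "scalar a * x = x * scalar a"
  by (cases x) (simp add: scalar_def lact_const mu_zero mult.commute)

section \<open>Units and group commutators\<close>

lemma unipotent_inverse: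
  "Alg 1 p q * Alg 1 (- p) (mu p p - q) = 1" "Alg 1 (- p) (mu p p - q) * Alg 1 p q = 1"
  using mu_diff[of 0 p p] mu_diff[of p 0 p]
  by (simp_all add: one_alg_def lact_hom ract_hom mu_zero)

definition y_unit :: "'a :: comm_ring_1 trunc" where
  "y_unit = Trunc 1 1 0"

definition y_unit_inv :: "'a :: comm_ring_1 trunc" where
  "y_unit_inv = Trunc 1 (- 1) 1"

lemma y_unit_inverse: "y_unit * y_unit_inv = 1" "y_unit_inv * y_unit = 1"
  by (simp_all add: y_unit_def y_unit_inv_def one_trunc_def)

lemma y_unit_alg_inverse:
  "Alg y_unit 0 0 * Alg y_unit_inv 0 0 = 1" "Alg y_unit_inv 0 0 * Alg y_unit 0 0 = 1"
  by (simp_all add: y_unit_inverse one_alg_def mu_zero)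

text \<open>Conjugation by \<open>1 + y\<close> multiplies \<open>B x\<close> and \<open>B w\<close> by \<open>(1 + t)/(1 + s)\<close>;
  \<open>conj_factor\<close> is this factor minus one.\<close>

definition conj_factor :: "'a :: comm_ring_1 trunc trunc" where
  "conj_factor = lact y_unit_inv * ract y_unit - 1"

text \<open>The commutator is the inverse of \<open>Alg 1 p q\<close> times its conjugate by
  \<open>1 + y\<close>. It is again unipotent, so iterated commutators amount to iterating a map on
  pairs \<open>(p, q)\<close>.\<close>

lemma unipotent_commutator:
  "Alg 1 (- p) (mu p p - q) * Alg y_unit_inv 0 0 * Alg 1 p q * Alg y_unit 0 0 =
   Alg 1 (p * conj_factor) (q * conj_factor - mu p (p * conj_factor))"
proof -
  define c :: "'a trunc trunc" where "c = lact y_unit_inv * ract y_unit"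
  have "Alg y_unit_inv 0 0 * Alg 1 p q * Alg y_unit 0 0 = Alg 1 (p * c) (q * c)"
    by (simp add: y_unit_inverse ract_hom mu_zero c_def mult_ac)
  then have *: "Alg 1 (- p) (mu p p - q) * Alg y_unit_inv 0 0 * Alg 1 p q * Alg y_unit 0 0 =
      Alg 1 (- p) (mu p p - q) * Alg 1 (p * c) (q * c)"
    by (simp only: mult.assoc)
  have "p * conj_factor = p * c - p" "q * conj_factor = q * c - q"
    by (simp_all add: conj_factor_def c_def right_diff_distrib)
  then show ?thesis
    unfolding * using mu_diff(1)[of 0 p "p * c"]
    by (simp add: lact_hom ract_hom mu_zero mu_diff(2))
qed

abbreviation commutator_step where
  "commutator_step \<equiv> \<lambda>(p, q). (p * conj_factor, q * conj_factor - mu p (p * conj_factor))"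

text \<open>The pair \<open>(1, 0)\<close> stands for \<open>1 + x\<close>. The first component
  vanishes since \<open>conj_factor\<close> has no constant term; in the second only
  \<open>s t\<close> squared survives.\<close>

lemma commutator_steps:
  "(commutator_step ^^ 5) (1, 0) = (0, Trunc 0 0 (Trunc 0 0 (- 18 :: 'a :: comm_ring_1)))"
proof -
  have c: "conj_factor = (Trunc (Trunc 0 1 0) (Trunc (- 1) (- 1) 0) (Trunc 1 1 0) :: 'a trunc trunc)"
    by (simp add: conj_factor_def y_unit_def y_unit_inv_def mu_simps)
  show ?thesis
    unfolding c by (simp add: mu_simps eval_nat_numeral)
qed

section \<open>The quotient by the kernel of an evaluation\<close>

locale alg_quotient = quotient_algebra K ev scalar E
  for K :: "('k, 'm) ring_scheme" (structure)
    and ev :: "'a :: comm_ring_1 \<Rightarrow> 'k"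
    and E :: "'a alg \<Rightarrow> 'r" +
  assumes E_eq_iff: "E (Alg a p q) = E (Alg a' p' q') \<longleftrightarrow>
    rel_trunc (\<lambda>a b. ev a = ev b) a a' \<and>
    rel_trunc (rel_trunc (\<lambda>a b. ev a = ev b)) p p' \<and>
    rel_trunc (rel_trunc (\<lambda>a b. ev a = ev b)) q q'"
begin

lemma lie_engel_quot: "lie_engel quot 5"
  unfolding lie_engel_def
  by (auto simp: quot_simps lie_iter_quot alg_lie_engel)

lemma unipotent_grp_comm:
  "grp_comm (units_of quot) (E (Alg 1 p q)) (E (Alg y_unit 0 0)) =
   E (case commutator_step (p, q) of (p', q') \<Rightarrow> Alg 1 p' q')"
  by (simp add: grp_comm_quot[OF unipotent_inverse y_unit_alg_inverse] unipotent_commutator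
      del: times_alg.simps)

lemma unipotent_grp_comm_iter:
  "grp_comm_iter (units_of quot) (E (Alg 1 p q)) n (E (Alg y_unit 0 0)) =
   E (case (commutator_step ^^ n) (p, q) of (p', q') \<Rightarrow> Alg 1 p' q')"
proof (induction n)
  case (Suc n)
  obtain p' q' where "(commutator_step ^^ n) (p, q) = (p', q')" by fastforce
  with Suc show ?case by (simp add: unipotent_grp_comm)
qed simp

lemma not_group_engel_quot:
  assumes "ev 2 \<noteq> \<zero>" "ev 3 \<noteq> \<zero>"
  shows "\<not> group_engel (units_of quot) 5"
proof
  assume engel: "group_engel (units_of quot) 5"
  have "E (Alg y_unit 0 0) \<in> carrier (units_of quot)"
    unfolding units_of_carrier using y_unit_alg_inverse by (rule unit_quot)
  moreover have "E (Alg 1 1 0) \<in> carrier (units_of quot)"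
    unfolding units_of_carrier using unipotent_inverse by (rule unit_quot)
  ultimately have "grp_comm_iter (units_of quot) (E (Alg 1 1 0)) 5 (E (Alg y_unit 0 0)) = E 1"
    using engel by (simp add: group_engel_def units_of_one quot_simps)
  then have "E (Alg 1 0 (Trunc 0 0 (Trunc 0 0 (- 18)))) = E (Alg 1 0 0)"
    by (simp add: unipotent_grp_comm_iter commutator_steps one_alg_def)
  then have "ev (- 18) = ev 0"
    by (simp add: E_eq_iff zero_trunc_def)
  \<comment> \<open>Since 18 = 2 * 3 * 3, its vanishing in the field would force 2 or 3 to
    vanish.\<close>
  moreover have "ev 2 \<otimes> (ev 3 \<otimes> ev 3) = ev (- 1) \<otimes> ev (- 18)"
    by (simp flip: ev_mult)
  ultimately have "ev 2 \<otimes> (ev 3 \<otimes> ev 3) = \<zero>"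
    by (simp add: ev_closed ev_zero)
  then show False
    using assms by (simp add: K.integral_iff ev_closed)
qed

lemma nilpotent_quot: "nilpotent_elem quot (E x_elt)" "nilpotent_elem quot (E y_elt)"
proof -
  have "x_elt ^ 2 = (0 :: 'a alg)"
    by (simp add: x_elt_def zero_alg_def power2_eq_square lact_hom ract_hom)
      (simp add: mu_simps)
  moreover have "y_elt ^ 3 = (0 :: 'a alg)"
    by (simp add: y_elt_def zero_alg_def power3_eq_cube mu_zero)
      (simp add: y_gen_def zero_trunc_def)
  ultimately show "nilpotent_elem quot (E x_elt)" "nilpotent_elem quot (E y_elt)"
    unfolding nilpotent_elem_def pow_quot by (metis quot_simps(3))+
qed

lemma generated_quot:
  assumes "ev 3 \<noteq> \<zero>"
  shows "alg_generated K quot {E x_elt, E y_elt} = carrier quot"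
proof
  let ?G = "alg_generated K quot {E x_elt, E y_elt}"
  show "?G \<subseteq> carrier quot"
    by (rule alg_generated_quot_subset) auto
  have X: "E x_elt \<in> ?G" and Y: "E y_elt \<in> ?G"
    by (auto intro: alg_generated.gen)
  have "E (scalar a) \<in> ?G" for a
    using alg_generated_scale[OF alg_generated_one, of a] by simp
  note closed = this alg_generated_add alg_generated_mult alg_generated_one X Y
  have poly: "E (Alg a 0 0) \<in> ?G" for a
  proof (cases a)
    case (Trunc a0 a1 a2)
    have "Alg a 0 0 = scalar a0 * 1 + scalar a1 * y_elt + scalar a2 * (y_elt * y_elt)"
      by (simp add: Trunc scalar_def y_elt_def one_alg_def mu_zero)
        (simp add: y_gen_def const_def one_trunc_def)
    then show ?thesis by (simp add: closed del: times_alg.simps)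
  qed
  have span: "E (Alg 0 p 0) \<in> ?G" for p
  proof (cases p)
    case (Trunc b0 b1 b2)
    have "Alg 0 p 0 = x_elt * Alg b0 0 0 + y_elt * x_elt * Alg b1 0 0 + y_elt * y_elt * x_elt * Alg b2 0 0"
      by (simp add: Trunc x_elt_def y_elt_def mu_zero lact_hom ract_hom)
        (cases b0; cases b1; cases b2; simp add: mu_simps)
    then show ?thesis by (simp add: closed poly del: times_alg.simps)
  qed
  have W: "E (Alg 0 0 1) \<in> ?G"
  proof -
    \<comment> \<open>As \<open>x y x = -3 w\<close>, recovering \<open>w\<close> requires inverting
      3.\<close>
    have "ev (- 3) \<noteq> \<zero>"
      using assms ev_mult[of "- 1" "- 3"] by (auto simp: ev_closed)
    then have "ev (- 3) \<in> Units K"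
      by (simp add: K.field_Units ev_closed)
    then obtain t where t: "ev t \<otimes> ev (- 3) = \<one>"
      using K.Units_l_inv_ex ev_surj by metis
    have "x_elt * y_elt * x_elt = (scalar (- 3) * Alg 0 0 1 :: 'a alg)"
      by (simp add: x_elt_def y_elt_def scalar_def lact_hom ract_hom mu_zero)
        (simp add: mu_simps)
    then have "scalar t * (x_elt * y_elt * x_elt) = scalar (t * - 3) * Alg 0 0 1"
      by (simp only: scalar_hom mult.assoc[of "scalar t"])
    \<comment> \<open>The product \<open>t * - 3\<close> is known to be 1 only after evaluation, so
      the cancellation takes place under \<open>E\<close>.\<close>
    moreover have "E (scalar (t * - 3) * Alg 0 0 1) = E (scalar 1 * Alg 0 0 1)"
      using t by (intro E_mult E_em) (simp_all only: ev_mult ev_one)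
    ultimately have "E (Alg 0 0 1) = E (scalar t * (x_elt * y_elt * x_elt))"
      by (simp add: scalar_hom)
    then show ?thesis by (simp add: closed)
  qed
  have top: "E (Alg 0 0 q) \<in> ?G" for q
  proof (cases q)
    case (Trunc b0 b1 b2)
    have "Alg 0 0 q = Alg 0 0 1 * Alg b0 0 0 + y_elt * Alg 0 0 1 * Alg b1 0 0
        + y_elt * y_elt * Alg 0 0 1 * Alg b2 0 0"
      by (simp add: Trunc y_elt_def mu_zero lact_hom ract_hom)
        (cases b0; cases b1; cases b2; simp add: mu_simps)
    then show ?thesis by (simp add: closed poly W del: times_alg.simps)
  qed
  show "carrier quot \<subseteq> ?G"
  proof
    fix x assume "x \<in> carrier quot"
    then obtain z where x: "x = E z" by (auto simp: quot_simps)
    obtain a p q where z: "z = Alg a p q" by (cases z)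
    have "z = Alg a 0 0 + Alg 0 p 0 + Alg 0 0 q" by (simp add: z)
    then show "x \<in> ?G" unfolding x by (simp only:) (intro alg_generated_add poly span top)
  qed
qed

end

section \<open>Congruences and coordinates\<close>

definition cring_cong :: "('a :: comm_ring_1 \<Rightarrow> 'a \<Rightarrow> bool) \<Rightarrow> bool" where
  "cring_cong R \<longleftrightarrow> (\<forall>a. R a a) \<and>
     (\<forall>a b c d. R a b \<longrightarrow> R c d \<longrightarrow> R (a + c) (b + d) \<and> R (a - c) (b - d) \<and> R (a * c) (b * d))"

lemma cring_congD:
  assumes "cring_cong R"
  shows "R a a"
    and "R a b \<Longrightarrow> R c d \<Longrightarrow> R (a + c) (b + d)"
    and "R a b \<Longrightarrow> R c d \<Longrightarrow> R (a - c) (b - d)"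
    and "R a b \<Longrightarrow> R c d \<Longrightarrow> R (a * c) (b * d)"
  using assms by (simp_all add: cring_cong_def)

text \<open>Sums and products in \<open>trunc\<close> are polynomial in the coefficients. Applied
  twice, this carries the kernel of evaluation to \<open>B\<close>.\<close>

lemma cring_cong_trunc:
  assumes "cring_cong R"
  shows "cring_cong (rel_trunc R)"
  unfolding cring_cong_def
  by (auto simp: trunc.rel_refl cring_congD[OF assms] elim!: trunc.rel_cases)

text \<open>\<open>mu\<close> is built from ring operations and fixed constants; reflexivity takes
  care of the constants.\<close>

lemma cring_cong_mu:
  assumes R: "cring_cong R"
    and p: "rel_trunc (rel_trunc R) p p'" and q: "rel_trunc (rel_trunc R) q q'"
  shows "rel_trunc (rel_trunc R) (mu p q) (mu p' q')"
proof -
  note S = cring_cong_trunc[OF R]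
  note T = cring_cong_trunc[OF S]
  have const: "rel_trunc R (const a) (const b)" if "R a b" for a b
    using that cring_congD(1)[OF R] by (simp add: const_def)
  have mid: "rel_trunc R (mid1 a q) (mid1 b q')" "rel_trunc R (mid2 a q) (mid2 b q')"
    if "rel_trunc R a b" for a b
    using that q
    by (cases a; cases b; cases q; cases q'; auto intro!: cring_congD[OF S] const)+
  have rows: "rel_trunc (rel_trunc R) (map_trunc f p) (map_trunc g p')"
    if "\<And>a b. rel_trunc R a b \<Longrightarrow> rel_trunc R (f a) (g b)" for f g
    using p that by (cases p; cases p') simp
  show ?thesis
    unfolding mu_def by (intro cring_congD[OF T] rows mid)
qed

lemma cring_cong_lact_ract:
  assumes R: "cring_cong R"
  shows cring_cong_lact: "rel_trunc R a b \<Longrightarrow> rel_trunc (rel_trunc R) (lact a) (lact b)"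
    and cring_cong_ract: "rel_trunc R a b \<Longrightarrow> rel_trunc (rel_trunc R) (ract a) (ract b)"
  using cring_congD(1)[OF R] by (auto simp: const_def ract_def zero_trunc_def elim!: trunc.rel_cases)

fun trunc_list :: "'a trunc \<Rightarrow> 'a list" where
  "trunc_list (Trunc a b c) = [a, b, c]"

text \<open>Once evaluated, the list of 21 coefficients is a canonical form for a class, which
  realizes the quotient on \<open>'k list\<close>.\<close>

fun coords :: "'a alg \<Rightarrow> 'a list" where
  "coords (Alg a p q) = trunc_list a @ concat (map trunc_list (trunc_list p @ trunc_list q))"

text \<open>All blocks have length three, so concatenated lists agree only if they agree block by
  block.\<close>

lemma map_coords_eq_iff:
  "map f (coords (Alg a p q)) = map f (coords (Alg a' p' q')) \<longleftrightarrow>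
    rel_trunc (\<lambda>a b. f a = f b) a a' \<and>
    rel_trunc (rel_trunc (\<lambda>a b. f a = f b)) p p' \<and>
    rel_trunc (rel_trunc (\<lambda>a b. f a = f b)) q q'"
proof -
  have 1: "map f (trunc_list a) = map f (trunc_list b) \<longleftrightarrow> rel_trunc (\<lambda>a b. f a = f b) a b"
    "length (trunc_list a) = 3" for a b
    by (cases a; cases b; simp)+
  show ?thesis
    by (cases p; cases q; cases p'; cases q') (simp add: 1)
qed

lemma alg_quotient_eval:
  assumes "field K"
  shows "alg_quotient K (eval_in K) (\<lambda>x. map (eval_in K) (coords x))"
proof -
  interpret K: field K by (fact assms)
  have cong: "cring_cong (\<lambda>a b. eval_in K a = eval_in K b)"
    by (simp add: cring_cong_def K.eval_in_add K.eval_in_diff K.eval_in_mult)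
  note congs = cring_congD[OF cring_cong_trunc[OF cong]]
    cring_congD[OF cring_cong_trunc[OF cring_cong_trunc[OF cong]]]
    cring_cong_mu[OF cong] cring_cong_lact_ract[OF cong]
  show ?thesis
  proof
    fix a b :: "'a free_cring" and x y x' y' :: "'a free_cring alg"
    show "eval_in K (a + b) = eval_in K a \<oplus>\<^bsub>K\<^esub> eval_in K b"
      by (fact K.eval_in_add)
    show "eval_in K (a * b) = eval_in K a \<otimes>\<^bsub>K\<^esub> eval_in K b"
      by (fact K.eval_in_mult)
    show "eval_in K 1 = \<one>\<^bsub>K\<^esub>"
      by (fact K.eval_in_one)
    show "range (eval_in K) = carrier K"
      by (fact K.range_eval_in)
    show "scalar (a + b) = scalar a + scalar b" "scalar (a * b) = scalar a * scalar b"
      "(scalar 1 :: 'a free_cring alg) = 1" "scalar a * x = x * scalar a"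
      by (fact scalar_hom scalar_central)+
    show "map (eval_in K) (coords (scalar a)) = map (eval_in K) (coords (scalar b))"
      if "eval_in K a = eval_in K b"
      using that by (simp add: scalar_def const_def)
    assume "map (eval_in K) (coords x) = map (eval_in K) (coords x')"
      "map (eval_in K) (coords y) = map (eval_in K) (coords y')"
    then show "map (eval_in K) (coords (x + y)) = map (eval_in K) (coords (x' + y'))"
      "map (eval_in K) (coords (x * y)) = map (eval_in K) (coords (x' * y'))"
      by (cases x; cases y; cases x'; cases y';
          simp add: map_coords_eq_iff congs del: coords.simps)+
  qed (fact map_coords_eq_iff)
qed

theorem theorem1p1:
  fixes K :: "('k, 'm) ring_scheme"
  assumes "field K"
    and "\<one>\<^bsub>K\<^esub> \<oplus>\<^bsub>K\<^esub> \<one>\<^bsub>K\<^esub> \<noteq> \<zero>\<^bsub>K\<^esub>"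
    and "\<one>\<^bsub>K\<^esub> \<oplus>\<^bsub>K\<^esub> \<one>\<^bsub>K\<^esub> \<oplus>\<^bsub>K\<^esub> \<one>\<^bsub>K\<^esub> \<noteq> \<zero>\<^bsub>K\<^esub>"
  shows "\<exists>R :: ('k, 'k list) module.
           unital_assoc_algebra K R \<and> lie_engel R 5 \<and> \<not> group_engel (units_of R) 5 \<and>
           (\<exists>a\<in>carrier R. \<exists>b\<in>carrier R. nilpotent_elem R a \<and> nilpotent_elem R b \<and>
              alg_generated K R {a, b} = carrier R)"
proof -
  interpret Q: alg_quotient K "eval_in K" "\<lambda>x. map (eval_in K) (coords x)"
    using assms(1) by (rule alg_quotient_eval)
  have "eval_in K (1 + 1) \<noteq> \<zero>\<^bsub>K\<^esub>" "eval_in K (1 + 1 + 1) \<noteq> \<zero>\<^bsub>K\<^esub>"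
    unfolding Q.ev_add Q.ev_one by (fact assms)+
  then have "eval_in K 2 \<noteq> \<zero>\<^bsub>K\<^esub>" "eval_in K 3 \<noteq> \<zero>\<^bsub>K\<^esub>"
    by simp_all
  moreover have "map (eval_in K) (coords x) \<in> carrier Q.quot" for x
    by (simp add: Q.quot_simps)
  ultimately show ?thesis
    using Q.unital_assoc_algebra_quot Q.lie_engel_quot Q.not_group_engel_quot
      Q.nilpotent_quot Q.generated_quot
    by blast
qed

end
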